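(* Let $1<p<\infty$. Let $\alpha=(\alpha_j)_{j\in\mathbb{N}}$ be the probability on $\mathbb{N}=\{0,1,2,\dots\}$ with generating function $\sum_{j\ge 0}\alpha_j x^j=\frac{1-\sqrt{1-x}}{x}$, and let $L_p=\ell^p(\mathbb{N},\alpha)$ be the space of functions $f:\mathbb{N}\to\mathbb{R}$ with $\|f\|_p=\left(\sum_{k\ge 0}\alpha_k|f(k)|^p\right)^{1/p}<\infty$. For $f\in L_p$ and $k\in\mathbb{N}$ put $$A(f)(k)=\sum_{j=0}^{\infty}\alpha_j f(j+k).$$ Then the series converge absolutely, $A$ is a positive bounded linear operator from $L_p$ to $L_p$, and: (1) the sequence of powers of $A$ is sub-additive: $A^{n+m}\le A^n+A^m$ for all $n,m\in\mathbb{N}$; (2) $\lim_{n\to\infty}\|A^n\|_p/n=0$; (3) the powers of $A$ are not bounded in norm: $\sup_n\|A^n\|_p=\infty$; (4) there exists $f\in L_p$ such that $A^n(f)(k)$ does not converge (to a finite limit) at any point $k\in\mathbb{N}$. More precisely, the function $f(k)=k^{2/(5p)}$ belongs to $L_p$ and satisfies $\lim_{n\to\infty}A^n(f)(k)=\infty$ for every $k\in\mathbb{N}$ and $\lim_{n\to\infty}\|A^n(f)\|_p=\infty$. In particular, it is false that every positive operator $A$ on an $L_p$ space ($1<p<\infty$) with sub-additive sequence of powers and $\lim_n\|A^n\|_p/n=0$ has powers bounded in norm; and it is false that for every such operator the sequence $A^n(f)$ converges almost everywhere for every $f\in L_p$.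
   Context: Here $\|A^n\|_p$ denotes the operator norm of $A^n$ on $L_p$, and $A^0=I$ is the identity. A linear operator $B$ on $L_p$ is positive if $f\ge 0$ implies $B(f)\ge 0$; for operators $B,C$ on $L_p$, $B\le C$ means $B(f)\le C(f)$ for every $f\in L_p$ with $f\ge 0$. *)

theory Defs
  imports "HOL-Probability.Probability" "HOL-Analysis.Generalised_Binomial_Theorem"
begin

section \<open>$L_p$ spaces and operators on them\<close>

text \<open>
  Elements of $L_p$ are represented by functions; equality, order and linearity of operators are
  understood modulo null sets, and operators are required to respect equality almost everywhere.
\<close>

definition Lp :: "real \<Rightarrow> 'a measure \<Rightarrow> ('a \<Rightarrow> real) set" where
  "Lp p M = {f \<in> borel_measurable M. integrable M (\<lambda>x. \<bar>f x\<bar> powr p)}"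

definition Lp_norm :: "real \<Rightarrow> 'a measure \<Rightarrow> ('a \<Rightarrow> real) \<Rightarrow> real" where
  "Lp_norm p M f = (\<integral>x. \<bar>f x\<bar> powr p \<partial>M) powr (1 / p)"

definition Lp_bounded_linear ::
    "real \<Rightarrow> 'a measure \<Rightarrow> (('a \<Rightarrow> real) \<Rightarrow> 'a \<Rightarrow> real) \<Rightarrow> bool" where
  "Lp_bounded_linear p M T \<longleftrightarrow>
     (\<forall>f\<in>Lp p M. T f \<in> Lp p M) \<and>
     (\<forall>f\<in>Lp p M. \<forall>g\<in>Lp p M. (AE x in M. f x = g x) \<longrightarrow> (AE x in M. T f x = T g x)) \<and>
     (\<forall>f\<in>Lp p M. \<forall>g\<in>Lp p M. AE x in M. T (\<lambda>y. f y + g y) x = T f x + T g x) \<and>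
     (\<forall>c. \<forall>f\<in>Lp p M. AE x in M. T (\<lambda>y. c * f y) x = c * T f x) \<and>
     (\<exists>C. \<forall>f\<in>Lp p M. Lp_norm p M (T f) \<le> C * Lp_norm p M f)"

definition Lp_positive ::
    "real \<Rightarrow> 'a measure \<Rightarrow> (('a \<Rightarrow> real) \<Rightarrow> 'a \<Rightarrow> real) \<Rightarrow> bool" where
  "Lp_positive p M B \<longleftrightarrow>
     (\<forall>f\<in>Lp p M. (AE x in M. 0 \<le> f x) \<longrightarrow> (AE x in M. 0 \<le> B f x))"

definition Lp_op_le :: "real \<Rightarrow> 'a measure \<Rightarrow>
    (('a \<Rightarrow> real) \<Rightarrow> 'a \<Rightarrow> real) \<Rightarrow> (('a \<Rightarrow> real) \<Rightarrow> 'a \<Rightarrow> real) \<Rightarrow> bool" where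
  "Lp_op_le p M B C \<longleftrightarrow>
     (\<forall>f\<in>Lp p M. (AE x in M. 0 \<le> f x) \<longrightarrow> (AE x in M. B f x \<le> C f x))"

definition Lp_subadditive_powers ::
    "real \<Rightarrow> 'a measure \<Rightarrow> (('a \<Rightarrow> real) \<Rightarrow> 'a \<Rightarrow> real) \<Rightarrow> bool" where
  "Lp_subadditive_powers p M T \<longleftrightarrow>
     (\<forall>n m. Lp_op_le p M (T ^^ (n + m)) (\<lambda>f x. (T ^^ n) f x + (T ^^ m) f x))"

text \<open>The supremum is meaningful only for bounded operators (it is a real number).\<close>

definition Lp_opnorm ::
    "real \<Rightarrow> 'a measure \<Rightarrow> (('a \<Rightarrow> real) \<Rightarrow> 'a \<Rightarrow> real) \<Rightarrow> real" where
  "Lp_opnorm p M T = (SUP f\<in>{f \<in> Lp p M. Lp_norm p M f \<le> 1}. Lp_norm p M (T f))"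


section \<open>The probability with generating function $(1-\sqrt{1-x})/x$\<close>

text \<open>The point $x = 0$ is excluded because of the convention $y / 0 = 0$.\<close>

definition has_sqrt_genfun :: "nat pmf \<Rightarrow> bool" where
  "has_sqrt_genfun a \<longleftrightarrow>
     (\<forall>x::real. x \<noteq> 0 \<longrightarrow> \<bar>x\<bar> < 1 \<longrightarrow> (\<lambda>j. pmf a j * x ^ j) sums ((1 - sqrt (1 - x)) / x))"

definition alpha :: "nat pmf" where
  "alpha = (THE a. has_sqrt_genfun a)"

definition alpha_op :: "(nat \<Rightarrow> real) \<Rightarrow> nat \<Rightarrow> real" where
  "alpha_op f k = (\<Sum>j. pmf alpha j * f (j + k))"


subsection \<open>Existence and uniqueness\<close>

lemma powser_eq_0:
  fixes d :: "nat \<Rightarrow> real"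
  assumes "\<And>x. x \<noteq> 0 \<Longrightarrow> \<bar>x\<bar> < 1 \<Longrightarrow> (\<lambda>n. d n * x ^ n) sums 0"
  shows "d n = 0"
  using assms
proof (induction n arbitrary: d)
  case zero: 0
  have "((\<lambda>x::real. 0::real) \<longlongrightarrow> d 0) (at 0)"
    by (rule powser_limit_0_strong[where s = 1]) (use zero in auto)
  then show ?case by (metis tendsto_const_iff trivial_limit_at)
next
  case (Suc n)
  have d0: "d 0 = 0"
  proof -
    have "((\<lambda>x::real. 0::real) \<longlongrightarrow> d 0) (at 0)"
      by (rule powser_limit_0_strong[where s = 1]) (use Suc.prems in auto)
    then show ?thesis by (metis tendsto_const_iff trivial_limit_at)
  qed
  have "(\<lambda>n. d (Suc n) * x ^ n) sums 0" if "x \<noteq> 0" "\<bar>x\<bar> < 1" for x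
  proof -
    have "(\<lambda>n. d (Suc n) * x ^ Suc n) sums 0"
      using Suc.prems[OF that] d0 sums_Suc_iff[of "\<lambda>n. d n * x ^ n" 0] by simp
    from sums_mult[OF this, of "1 / x"] show ?thesis using that by (simp add: field_simps)
  qed
  then show ?case by (rule Suc.IH)
qed

lemma has_sqrt_genfun_unique:
  assumes "has_sqrt_genfun a" "has_sqrt_genfun b"
  shows "a = b"
proof (rule pmf_eqI)
  fix n
  have "pmf a n - pmf b n = 0"
  proof (rule powser_eq_0)
    fix x :: real assume "x \<noteq> 0" "\<bar>x\<bar> < 1"
    then show "(\<lambda>n. (pmf a n - pmf b n) * x ^ n) sums 0"
      using assms sums_diff[of "\<lambda>n. pmf a n * x ^ n" _ "\<lambda>n. pmf b n * x ^ n"]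
      unfolding has_sqrt_genfun_def by (fastforce simp: left_diff_distrib)
  qed
  then show "pmf a n = pmf b n" by simp
qed

definition alpha_coeff :: "nat \<Rightarrow> real" where
  "alpha_coeff j = (- 1) ^ j * ((1/2) gchoose Suc j)"

lemma alpha_coeff_pos: "alpha_coeff j > 0"
proof (induction j)
  case 0 then show ?case by (simp add: alpha_coeff_def)
next
  case (Suc j)
  have "(1/2 :: real) * ((1/2) gchoose Suc j) =
      of_nat (Suc j) * ((1/2) gchoose Suc j) + of_nat (Suc (Suc j)) * ((1/2) gchoose Suc (Suc j))"
    by (rule gbinomial_mult_1)
  then have "((1/2::real) gchoose Suc (Suc j)) =
      ((1/2) gchoose Suc j) * (1/2 - of_nat (Suc j)) / of_nat (Suc (Suc j))"
    by (simp add: field_simps del: of_nat_Suc)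
  then have "alpha_coeff (Suc j) = alpha_coeff j * ((of_nat (Suc j) - 1/2) / of_nat (Suc (Suc j)))"
    unfolding alpha_coeff_def by (simp add: power_Suc diff_divide_distrib right_diff_distrib del: of_nat_Suc)
  moreover have "(of_nat (Suc j) - 1/2 :: real) / of_nat (Suc (Suc j)) > 0" by simp
  ultimately show ?case using Suc.IH by (metis mult_pos_pos)
qed

lemma alpha_coeff_sums:
  assumes "x \<noteq> 0" "\<bar>x\<bar> < 1"
  shows "(\<lambda>j. alpha_coeff j * x ^ j) sums ((1 - sqrt (1 - x)) / x)"
proof -
  have "(\<lambda>n. ((1/2) gchoose n) * (- x) ^ n) sums sqrt (1 + - x)"
    by (rule sqrt_series) (use assms in auto)
  then have "(\<lambda>n. ((1/2) gchoose Suc n) * (- x) ^ Suc n) sums (sqrt (1 - x) - 1)"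
    using sums_Suc_iff[of "\<lambda>n. ((1/2) gchoose n) * (- x) ^ n" "sqrt (1 - x) - 1"] by simp
  from sums_mult[OF this, of "- 1 / x"]
  have "(\<lambda>n. - 1 / x * (((1/2) gchoose Suc n) * (- x) ^ Suc n)) sums (- 1 / x * (sqrt (1 - x) - 1))" .
  moreover have "(\<lambda>n. - 1 / x * (((1/2) gchoose Suc n) * (- x) ^ Suc n)) =
      (\<lambda>j. alpha_coeff j * x ^ j)"
  proof
    fix n
    have "(- x) ^ Suc n = - x * ((- 1) ^ n * x ^ n)"
      by (simp only: power_Suc power_minus[of x n])
    then show "- 1 / x * (((1/2) gchoose Suc n) * (- x) ^ Suc n) = alpha_coeff n * x ^ n"
      using assms by (simp add: alpha_coeff_def field_simps)
  qed
  moreover have "- 1 / x * (sqrt (1 - x) - 1) = (1 - sqrt (1 - x)) / x"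
    using assms by (simp add: field_simps)
  ultimately show ?thesis by simp
qed

lemma alpha_coeff_sums_1: "alpha_coeff sums 1"
proof -
  have le1: "(\<Sum>j<n. alpha_coeff j) \<le> 1" for n
  proof -
    have "((\<lambda>x. \<Sum>j<n. alpha_coeff j * x ^ j) \<longlongrightarrow> (\<Sum>j<n. alpha_coeff j * 1 ^ j)) (at_left (1::real))"
      by (intro tendsto_intros)
    moreover have "\<forall>\<^sub>F x in at_left (1::real). (\<Sum>j<n. alpha_coeff j * x ^ j) \<le> 1"
      unfolding eventually_at_left_field
    proof (intro exI[of _ 0] conjI allI impI)
      fix x :: real assume x: "0 < x" "x < 1"
      then have s: "(\<lambda>j. alpha_coeff j * x ^ j) sums ((1 - sqrt (1 - x)) / x)"
        by (intro alpha_coeff_sums) auto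
      have "(\<Sum>j<n. alpha_coeff j * x ^ j) \<le> (\<Sum>j. alpha_coeff j * x ^ j)"
        using s x alpha_coeff_pos
        by (intro sum_le_suminf) (auto simp: sums_iff intro!: mult_nonneg_nonneg intro: less_imp_le)
      also have "\<dots> = (1 - sqrt (1 - x)) / x" using s by (simp add: sums_iff)
      also have "\<dots> \<le> 1"
      proof -
        have "1 - x \<le> sqrt (1 - x)"
          using x by (intro real_le_rsqrt) (auto simp: power2_eq_square mult_le_cancel_left1)
        then show ?thesis using x by (simp add: divide_simps)
      qed
      finally show "(\<Sum>j<n. alpha_coeff j * x ^ j) \<le> 1" .
    qed simp
    ultimately show ?thesis
      using tendsto_upperbound[of "\<lambda>x. \<Sum>j<n. alpha_coeff j * x ^ j" _ "at_left (1::real)" 1] by simp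
  qed
  have summ: "summable alpha_coeff"
    by (rule summableI_nonneg_bounded[where x = 1]) (use alpha_coeff_pos le1 in \<open>auto intro: less_imp_le\<close>)
  have "suminf alpha_coeff \<le> 1"
    by (rule suminf_le_const[OF summ]) (rule le1)
  moreover have "1 \<le> suminf alpha_coeff"
  proof (rule tendsto_upperbound)
    show "((\<lambda>x. (1 - sqrt (1 - x)) / x) \<longlongrightarrow> 1) (at_left (1::real))"
      by (rule tendsto_eq_intros refl | simp)+
    show "\<forall>\<^sub>F x in at_left (1::real). (1 - sqrt (1 - x)) / x \<le> suminf alpha_coeff"
      unfolding eventually_at_left_field
    proof (intro exI[of _ 0] conjI allI impI)
      fix x :: real assume x: "0 < x" "x < 1"
      then have s: "(\<lambda>j. alpha_coeff j * x ^ j) sums ((1 - sqrt (1 - x)) / x)"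
        by (intro alpha_coeff_sums) auto
      show "(1 - sqrt (1 - x)) / x \<le> suminf alpha_coeff"
      proof (rule sums_le[OF _ s summable_sums[OF summ]])
        fix j
        have "x ^ j \<le> 1" using x by (intro power_le_one) auto
        then show "alpha_coeff j * x ^ j \<le> alpha_coeff j"
          using alpha_coeff_pos[of j] by (simp add: mult_le_cancel_left1)
      qed
    qed simp
  qed simp
  ultimately show ?thesis using summ by (simp add: sums_iff)
qed

lemma pmf_alpha_coeff: "pmf (embed_pmf alpha_coeff) j = alpha_coeff j"
proof (rule pmf_embed_pmf)
  show "(\<integral>\<^sup>+ x. ennreal (alpha_coeff x) \<partial>count_space UNIV) = 1"
    using alpha_coeff_sums_1 alpha_coeff_pos
    by (simp add: nn_integral_count_space_nat suminf_ennreal2 sums_iff less_imp_le)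
qed (use alpha_coeff_pos in \<open>auto intro: less_imp_le\<close>)

lemma ex1_has_sqrt_genfun: "\<exists>!a. has_sqrt_genfun a"
proof (rule ex1I[of _ "embed_pmf alpha_coeff"])
  show g: "has_sqrt_genfun (embed_pmf alpha_coeff)"
    unfolding has_sqrt_genfun_def using alpha_coeff_sums by (simp add: pmf_alpha_coeff)
  show "a = embed_pmf alpha_coeff" if "has_sqrt_genfun a" for a
    using has_sqrt_genfun_unique[OF that g] .
qed

lemma alpha_has_sqrt_genfun: "has_sqrt_genfun alpha"
  unfolding alpha_def using theI'[OF ex1_has_sqrt_genfun] .

lemma pmf_alpha: "pmf alpha j = (- 1) ^ j * ((1/2) gchoose Suc j)"
proof -
  have "has_sqrt_genfun (embed_pmf alpha_coeff)"
    unfolding has_sqrt_genfun_def using alpha_coeff_sums by (simp add: pmf_alpha_coeff)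
  then have "alpha = embed_pmf alpha_coeff"
    using has_sqrt_genfun_unique alpha_has_sqrt_genfun by blast
  then have "pmf alpha j = alpha_coeff j"
    by (metis pmf_alpha_coeff)
  then show ?thesis by (simp only: alpha_coeff_def)
qed

lemma pmf_alpha_pos: "pmf alpha j > 0"
  using alpha_coeff_pos[of j] by (simp add: pmf_alpha alpha_coeff_def)


subsection \<open>$L_p$ of this probability is the weighted space $\ell^p$\<close>

lemma Lp_alpha_iff: "f \<in> Lp p (measure_pmf alpha) \<longleftrightarrow> summable (\<lambda>k. pmf alpha k * \<bar>f k\<bar> powr p)"
  by (simp add: Lp_def measure_pmf_eq_density integrable_density integrable_count_space_nat_iff abs_mult)

lemma Lp_norm_alpha:
  assumes "f \<in> Lp p (measure_pmf alpha)"
  shows "Lp_norm p (measure_pmf alpha) f = (\<Sum>k. pmf alpha k * \<bar>f k\<bar> powr p) powr (1 / p)"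
proof -
  have "integrable (count_space UNIV) (\<lambda>k. pmf alpha k * \<bar>f k\<bar> powr p)"
    using assms by (simp add: Lp_alpha_iff integrable_count_space_nat_iff abs_mult)
  then show ?thesis
    by (simp add: Lp_norm_def measure_pmf_eq_density integral_density integral_count_space_nat)
qed

lemma AE_alpha_iff: "(AE k in measure_pmf alpha. P k) \<longleftrightarrow> (\<forall>k. P k)"
  using pmf_alpha_pos by (auto simp: AE_measure_pmf_iff set_pmf_iff less_imp_neq[symmetric])

end

theory Submission
  imports Defs "HOL-Real_Asymp.Real_Asymp"
begin

text \<open>
  Let \<open>G\<close> be the generating function of the probability. Since \<open>x G\<^sup>2 = 2 G - 1\<close>, the coefficients
  of \<open>G\<^sup>n\<close>, which are the weights of the \<open>n\<close>-th power of the operator, are \<open>n\<close> times the ballot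
  numbers \<open>binom (2 j + n) j / ((2 j + n) 2\<^bsup>2 j + n\<^esup>)\<close>. These decrease in \<open>n\<close>, so the
  weights are subadditive in \<open>n\<close>. By Jensen's inequality the \<open>p\<close>-th power of the norm of the \<open>n\<close>-th
  power is at most \<open>n + 1\<close>, because the weights of order \<open>n + 1\<close> are at most \<open>n + 1\<close> times those of
  order \<open>1\<close>. On the other hand the mass of the \<open>n\<close>-th weights escapes to infinity, so a monotone
  unbounded function in \<open>L\<^sub>p\<close> has powers growing to infinity at every point.
\<close>

section \<open>The convolution powers of the probability\<close>

abbreviation alpha_fps :: "real fps" where
  "alpha_fps \<equiv> Abs_fps (pmf alpha)"

text \<open>Formal power series make the relations between different orders purely algebraic, with
  no question of convergence. \<open>alpha_conv n\<close> is the law of a sum of \<open>n\<close>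
  independent variables with law \<open>alpha\<close>.\<close>

definition alpha_conv :: "nat \<Rightarrow> nat \<Rightarrow> real" where
  "alpha_conv n = fps_nth (alpha_fps ^ n)"

text \<open>With G for \<open>alpha_fps\<close>, the series 1 - X G is the binomial series of sqrt(1
  - X), so its square is 1 - X; expanding the square and cancelling X gives the equation.\<close>

lemma alpha_fps_functional_equation: "fps_X * alpha_fps ^ 2 = 2 * alpha_fps - 1"
proof -
  define c :: "real fps" where "c = Abs_fps (\<lambda>n. (- 1) ^ n * ((1/2) gchoose n))"
  have c: "c = 1 - fps_X * alpha_fps"
  proof (rule fps_ext)
    show "fps_nth c n = fps_nth (1 - fps_X * alpha_fps) n" for n
      by (cases n) (simp_all add: c_def pmf_alpha)
  qed
  have "c * c = 1 - fps_X"
  proof (rule fps_ext)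
    fix n
    have "fps_nth (c * c) n =
        (\<Sum>i=0..n. (- 1) ^ n * (((1/2) gchoose i) * ((1/2) gchoose (n - i))))"
      unfolding fps_mult_nth c_def
      by (intro sum.cong refl) (simp add: power_add[symmetric])
    \<comment> \<open>Vandermonde with 1/2 + 1/2 = 1: only the coefficients of order 0 and 1
      survive.\<close>
    also have "\<dots> = (- 1) ^ n * (1 gchoose n)"
      using gbinomial_Vandermonde[of "1/2::real" "1/2" n] by (simp add: sum_distrib_left[symmetric])
    also have "1 gchoose n = (of_nat (1 choose n) :: real)"
      using binomial_gbinomial[of 1 n, where 'a = real] by simp
    also have "(- 1) ^ n * (of_nat (1 choose n) :: real) = fps_nth (1 - fps_X) n"
      by (cases "n = 0"; cases "n = 1") (auto simp: fps_X_def binomial_eq_0)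
    finally show "fps_nth (c * c) n = fps_nth (1 - fps_X) n" .
  qed
  then have "fps_X * (fps_X * alpha_fps ^ 2 - (2 * alpha_fps - 1)) = 0"
    unfolding c by (simp add: algebra_simps power2_eq_square)
  then show ?thesis
    by (metis eq_iff_diff_eq_0 fps_X_neq_zero mult_eq_0_iff)
qed

lemma alpha_conv_0: "alpha_conv 0 j = (if j = 0 then 1 else 0)"
  by (simp add: alpha_conv_def)

lemma alpha_conv_1: "alpha_conv (Suc 0) = pmf alpha"
  by (simp add: alpha_conv_def fps_nth_Abs_fps fun_eq_iff)

lemma alpha_conv_Suc: "alpha_conv (Suc n) j = (\<Sum>i\<le>j. pmf alpha i * alpha_conv n (j - i))"
  by (simp add: alpha_conv_def fps_mult_nth atLeast0AtMost)

lemma alpha_conv_nonneg: "alpha_conv n j \<ge> 0"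
proof (induction n arbitrary: j)
  case (Suc n)
  then show ?case by (auto simp: alpha_conv_Suc intro!: sum_nonneg)
qed (simp add: alpha_conv_0)

text \<open>The functional equation times G^n. Comparing coefficients reaches order
  \<open>n + 1\<close> at \<open>j + 1\<close> from order \<open>n\<close> at \<open>j + 1\<close>
  and order \<open>n + 2\<close> at \<open>j\<close>, which suits a double induction.\<close>

lemma alpha_fps_power_recurrence:
  "fps_X * alpha_fps ^ (n + 2) = 2 * alpha_fps ^ Suc n - alpha_fps ^ n"
proof -
  have "fps_X * alpha_fps ^ (n + 2) = alpha_fps ^ n * (fps_X * alpha_fps ^ 2)"
    by (simp only: power_add mult_ac)
  then show ?thesis
    by (simp add: alpha_fps_functional_equation algebra_simps)
qed

lemma alpha_conv_recurrence_0: "2 * alpha_conv (Suc n) 0 = alpha_conv n 0"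
  using arg_cong[OF alpha_fps_power_recurrence[of n], of "\<lambda>F. fps_nth F 0"]
  by (simp add: alpha_conv_def numeral_fps_const del: power_Suc)

lemma alpha_conv_recurrence:
  "2 * alpha_conv (Suc n) (Suc j) = alpha_conv n (Suc j) + alpha_conv (n + 2) j"
  using arg_cong[OF alpha_fps_power_recurrence[of n], of "\<lambda>F. fps_nth F (Suc j)"]
  by (simp add: alpha_conv_def numeral_fps_const del: power_Suc)

text \<open>The ballot numbers: \<open>n * ballot n j\<close> is the probability that a simple random walk first
  goes from height \<open>n\<close> to \<open>0\<close> at time \<open>2 * j + n\<close>.\<close>

definition ballot :: "nat \<Rightarrow> nat \<Rightarrow> real" where
  "ballot n j = real ((2 * j + n) choose j) / (real (2 * j + n) * 2 ^ (2 * j + n))"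

text \<open>This mirrors the first step of the walk from height \<open>n + 1\<close>, to
  \<open>n\<close> or \<open>n + 2\<close> with probability 1/2 each. Pascal's rule and absorption
  reduce every binomial to \<open>N choose j\<close>, leaving a rational identity.\<close>

lemma ballot_recurrence:
  "2 * (real (Suc n) * ballot (Suc n) (Suc j)) =
     real n * ballot n (Suc j) + real (n + 2) * ballot (n + 2) j"
proof -
  define N where "N = 2 * j + n + 2"
  have idx: "2 * Suc j + Suc n = Suc N" "2 * Suc j + n = N" "2 * j + (n + 2) = N"
    by (simp_all add: N_def)
  have "Suc j * (N choose Suc j) = (N choose j) * (N - j)"
    using binomial_absorb_comp[of N j] binomial_absorption[of j N] by (simp add: mult.commute)
  then have "real (Suc j) * real (N choose Suc j) = real (N choose j) * real (N - j)"
    by (metis of_nat_mult)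
  then have D: "real (N choose Suc j) = real (N choose j) * (j + n + 2) / (j + 1)"
    by (simp add: N_def field_simps)
  have N: "real N = 2 * j + n + 2" by (simp add: N_def)
  have "2 * (real (Suc n) * ballot (Suc n) (Suc j)) =
      (real n + 1) * (real (N choose j) + real (N choose Suc j)) / ((real N + 1) * 2 ^ N)"
    unfolding ballot_def idx by (simp add: add.commute)
  also have "\<dots> = (real n * real (N choose Suc j) + (real n + 2) * real (N choose j)) / (real N * 2 ^ N)"
    unfolding D N by (simp add: divide_simps) (simp add: algebra_simps)
  also have "\<dots> = real n * ballot n (Suc j) + real (n + 2) * ballot (n + 2) j"
    unfolding ballot_def idx by (simp add: add_divide_distrib)
  finally show ?thesis .
qed

text \<open>Both sides obey the same recurrence, in \<open>n\<close> inside an induction on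
  \<open>j\<close>. The corner \<open>n = j = 0\<close> is excluded because
  \<open>alpha_conv 0 0 = 1\<close> while \<open>0 * ballot 0 0 = 0\<close>.\<close>

lemma alpha_conv_eq_ballot:
  assumes "n > 0 \<or> j > 0"
  shows "alpha_conv n j = real n * ballot n j"
  using assms
proof (induction j arbitrary: n)
  case 0
  have "alpha_conv n 0 = 1 / 2 ^ n" for n
  proof (induction n)
    case (Suc n)
    then show ?case using alpha_conv_recurrence_0[of n] by simp
  qed (simp add: alpha_conv_0)
  then show ?case using 0 by (simp add: ballot_def)
next
  case (Suc j)
  \<comment> \<open>Since \<open>n + 2 > 0\<close>, the outer hypothesis holds at every
    \<open>n\<close> and never meets the excluded corner.\<close>
  have step: "alpha_conv (n + 2) j = real (n + 2) * ballot (n + 2) j" for n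
    by (rule Suc.IH) simp
  show ?case
  proof (induction n)
    case 0
    show ?case by (simp add: alpha_conv_0)
  next
    case (Suc n)
    have "2 * alpha_conv (Suc n) (Suc j) = 2 * (real (Suc n) * ballot (Suc n) (Suc j))"
      unfolding ballot_recurrence alpha_conv_recurrence step Suc.IH ..
    then show ?case by simp
  qed
qed

text \<open>The ratio of the two sides is \<open>(2 * j + n) / (2 * (j + n + 1))\<close>, which is
  at most 1. At \<open>n = j = 0\<close> division by zero would make the right side 0 and the left
  side is 1/2.\<close>

lemma ballot_Suc_le:
  assumes "n > 0"
  shows "ballot (Suc n) j \<le> ballot n j"
proof -
  define N where "N = 2 * j + n"
  have idx: "2 * j + Suc n = Suc N" "2 * j + n = N"
    by (simp_all add: N_def)
  have "real (Suc N - j) * real (Suc N choose j) = real (Suc N) * real (N choose j)"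
    using binomial_absorb_comp[of "Suc N" j] by (metis of_nat_mult diff_Suc_1)
  then have D: "real (Suc N choose j) = real (Suc N) * real (N choose j) / (j + n + 1)"
    by (simp add: N_def field_simps)
  have "ballot (Suc n) j = real (N choose j) / (2 * real (j + n + 1) * 2 ^ N)"
    unfolding ballot_def idx D by (simp add: divide_simps)
  also have "\<dots> \<le> real (N choose j) / (real N * 2 ^ N)"
    using assms by (intro divide_left_mono mult_right_mono) (auto simp: N_def)
  finally show ?thesis by (simp add: ballot_def idx)
qed

lemma ballot_antimono:
  assumes "0 < m" "m \<le> n"
  shows "ballot n j \<le> ballot m j"
  using assms(2,1)
proof (induction n rule: dec_induct)
  case (step n)
  then show ?case using ballot_Suc_le[of n j] by simp
qed simp

text \<open>For positive orders, \<open>(n + m) * ballot (n + m) j\<close> splits into an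
  \<open>n\<close> part and an \<open>m\<close> part, and each is compared with the larger ballot
  number of lower order.\<close>

lemma alpha_conv_subadditive: "alpha_conv (n + m) j \<le> alpha_conv n j + alpha_conv m j"
proof (cases "n = 0 \<or> m = 0")
  case True
  then show ?thesis using alpha_conv_nonneg by auto
next
  case False
  then have "real n * ballot (n + m) j \<le> real n * ballot n j"
    "real m * ballot (n + m) j \<le> real m * ballot m j"
    by (auto intro!: mult_left_mono ballot_antimono)
  with False show ?thesis by (simp add: alpha_conv_eq_ballot distrib_right add_mono)
qed

lemma alpha_conv_Suc_le: "alpha_conv (Suc n) j \<le> real (Suc n) * pmf alpha j"
proof (induction n)
  case (Suc n)
  then show ?case
    using alpha_conv_subadditive[of "Suc 0" "Suc n" j] by (simp add: alpha_conv_1 algebra_simps)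
qed (simp add: alpha_conv_1)

section \<open>Decay of the probability\<close>

lemma pmf_alpha_0: "pmf alpha 0 = 1 / 2"
  by (simp add: pmf_alpha)

lemma pmf_alpha_Suc: "pmf alpha (Suc j) = pmf alpha j * ((real j + 1/2) / (real j + 2))"
proof -
  have "(1/2 :: real) * ((1/2) gchoose Suc j) =
      of_nat (Suc j) * ((1/2) gchoose Suc j) + of_nat (Suc (Suc j)) * ((1/2) gchoose Suc (Suc j))"
    by (rule gbinomial_mult_1)
  then have "((1/2::real) gchoose Suc (Suc j)) =
      - (((1/2) gchoose Suc j) * ((real j + 1/2) / (real j + 2)))"
    by (simp add: field_simps)
  then show ?thesis by (simp add: pmf_alpha del: times_divide_eq_right)
qed

text \<open>The 2 in the factor accommodates order 0, where
  \<open>alpha_conv 0 0 = 1 = 2 * pmf alpha 0\<close>.\<close>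

lemma alpha_conv_le: "alpha_conv n j \<le> real (n + 2) * pmf alpha j"
proof (cases n)
  case 0
  then show ?thesis by (simp add: alpha_conv_0 pmf_alpha_0)
next
  case (Suc m)
  have "alpha_conv n j \<le> real n * pmf alpha j" using alpha_conv_Suc_le[of m j] Suc by simp
  also have "\<dots> \<le> real (n + 2) * pmf alpha j" by (intro mult_right_mono) auto
  finally show ?thesis .
qed

text \<open>The tangent at 1 of the convex function \<open>t powr p\<close>. It serves both the
  decay of \<open>alpha\<close> and Jensen's inequality.\<close>

lemma Bernoulli_powr:
  fixes x p :: real
  assumes "p \<ge> 1" "x \<ge> -1"
  shows "1 + p * x \<le> (1 + x) powr p"
proof (cases "x = -1")
  case False
  have "(1 + x) powr p - 1 powr p \<ge> p * (1 + x - 1)"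
  proof (rule convex_on_imp_above_tangent[OF powr_convex[OF assms(1)]])
    show "((\<lambda>x. x powr p) has_real_derivative p) (at 1 within {0<..})"
      by (auto intro!: derivative_eq_intros)
  qed (use assms False in \<open>auto simp: interior_open\<close>)
  then show ?thesis by simp
qed (use assms in simp)

text \<open>The ratio of consecutive terms is 1 - (3/2) / (j + 2), so Bernoulli with exponent 3/2
  bounds it by \<open>((j + 1) / (j + 2)) powr (3/2)\<close>, and these bounds telescope.\<close>

lemma pmf_alpha_le: "pmf alpha j \<le> (real j + 1) powr (-3/2)"
proof (induction j)
  case (Suc j)
  define t where "t = - 1 / (real j + 2)"
  have "(real j + 1/2) / (real j + 2) = 1 + (3/2) * t"
    by (simp add: t_def field_simps)
  also have "\<dots> \<le> (1 + t) powr (3/2)"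
    by (rule Bernoulli_powr) (simp_all add: t_def divide_simps)
  also have "1 + t = (real j + 1) / (real j + 2)"
    by (simp add: t_def field_simps)
  also have "((real j + 1) / (real j + 2)) powr (3/2) = (real j + 1) powr (3/2) / (real j + 2) powr (3/2)"
    by (simp add: powr_divide)
  finally have "pmf alpha (Suc j) \<le>
      (real j + 1) powr (-3/2) * ((real j + 1) powr (3/2) / (real j + 2) powr (3/2))"
    unfolding pmf_alpha_Suc using Suc by (intro mult_mono) auto
  also have "\<dots> = (real (Suc j) + 1) powr (-3/2)"
    by (simp add: powr_minus field_simps)
  finally show ?case .
qed (simp add: pmf_alpha_0)

text \<open>Consecutive ratios are at least 1/4, their value at 0. The crude constant suffices
  because it only transfers summability to shifted functions.\<close>

lemma pmf_alpha_le_shift: "pmf alpha j \<le> 4 ^ k * pmf alpha (j + k)"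
proof (induction k)
  case (Suc k)
  define r where "r = (real (j + k) + 1/2) / (real (j + k) + 2)"
  have "1 / 4 \<le> r"
    by (simp add: r_def divide_simps)
  then have "4 ^ k * pmf alpha (j + k) * (1 / 4) \<le> 4 ^ k * pmf alpha (j + k) * r"
    by (intro mult_left_mono) auto
  then have "4 ^ k * pmf alpha (j + k) \<le> 4 ^ Suc k * pmf alpha (j + Suc k)"
    unfolding add_Suc_right pmf_alpha_Suc r_def[symmetric] by simp
  with Suc show ?case by linarith
qed simp

section \<open>The powers of the operator\<close>

text \<open>Fubini: averaging with \<open>v\<close> and then with \<open>u\<close> is averaging with
  their convolution. Absolute summability is assumed only for the convolved weights.\<close>

lemma sums_convolution:
  fixes u v g :: "nat \<Rightarrow> real"
  assumes nonneg: "\<And>i. u i \<ge> 0" "\<And>j. v j \<ge> 0"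
    and summ: "summable (\<lambda>m. (\<Sum>i\<le>m. u i * v (m - i)) * \<bar>g m\<bar>)"
  shows "(\<lambda>i. u i * (\<Sum>j. v j * g (i + j))) sums (\<Sum>m. (\<Sum>i\<le>m. u i * v (m - i)) * g m)"
proof -
  define h where "h = (\<lambda>(m, i). u i * v (m - i) * g m)"
  define T :: "(nat \<times> nat) set" where "T = Sigma UNIV (\<lambda>m. {..m})"
  have "(\<lambda>m. (\<Sum>i\<le>m. u i * v (m - i)) * \<bar>g m\<bar>) summable_on UNIV"
    using summ by (subst summable_on_UNIV_nonneg_real_iff)
      (auto intro!: mult_nonneg_nonneg sum_nonneg nonneg)
  then have "(\<lambda>x. norm (h x)) summable_on T"
    unfolding T_def Infinite_Sum.abs_summable_on_Sigma_iff
    by (simp add: h_def abs_mult nonneg sum_distrib_right[symmetric] abs_of_nonneg[OF sum_nonneg])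
  then have h: "h summable_on T" by (rule Infinite_Sum.abs_summable_summable)
  have "((\<lambda>m. (\<Sum>i\<le>m. u i * v (m - i)) * g m) has_sum infsum h T) UNIV"
  proof (rule has_sum_SigmaD)
    show "(h has_sum infsum h T) (Sigma UNIV (\<lambda>m. {..m}))"
      using h by (simp add: T_def)
    show "((\<lambda>i. h (m, i)) has_sum (\<Sum>i\<le>m. u i * v (m - i)) * g m) {..m}" for m
      using has_sum_finite[of "{..m}" "\<lambda>i. h (m, i)"] by (simp add: h_def sum_distrib_right)
  qed
  then have S: "infsum h T = (\<Sum>m. (\<Sum>i\<le>m. u i * v (m - i)) * g m)"
    by (rule has_sum_imp_sums[THEN sums_unique])
  define k where "k = (\<lambda>(i, j). u i * v j * g (i + j))"
  \<comment> \<open>Substituting \<open>m = i + j\<close> maps the triangle \<open>i \<le> m\<close>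
    bijectively onto the quadrant.\<close>
  have "(h has_sum infsum h T) T = (k has_sum infsum h T) (UNIV \<times> UNIV)"
    by (rule has_sum_reindex_bij_witness[of _ "\<lambda>(i, j). (i + j, i)" "\<lambda>(m, i). (i, m - i)"])
      (auto simp: T_def h_def k_def)
  with h have k: "(k has_sum infsum h T) (UNIV \<times> UNIV)" by simp
  have "((\<lambda>i. u i * (\<Sum>j. v j * g (i + j))) has_sum infsum h T) UNIV"
  proof (rule has_sum_SigmaD[OF k])
    fix i
    have "(\<lambda>j. k (i, j)) summable_on UNIV"
      using summable_on_SigmaD1[of "\<lambda>i j. k (i, j)" UNIV "\<lambda>_. UNIV" i] has_sum_imp_summable[OF k]
      by simp
    then have *: "((\<lambda>j. k (i, j)) has_sum (\<Sum>\<^sub>\<infinity>j. k (i, j))) UNIV" by simp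
    then have "(\<lambda>j. u i * (v j * g (i + j))) sums (\<Sum>\<^sub>\<infinity>j. k (i, j))"
      using has_sum_imp_sums by (simp add: k_def mult.assoc)
    \<comment> \<open>If \<open>u i = 0\<close> the inner series may diverge, but both sides are
      then 0; otherwise dividing by \<open>u i\<close> gives its convergence.\<close>
    then have "(\<Sum>\<^sub>\<infinity>j. k (i, j)) = u i * (\<Sum>j. v j * g (i + j))"
      by (cases "u i = 0") (auto simp: sums_iff suminf_mult[symmetric] dest: summable_mult_D)
    with * show "((\<lambda>j. k (i, j)) has_sum u i * (\<Sum>j. v j * g (i + j))) UNIV" by simp
  qed
  then show ?thesis
    unfolding S by (rule has_sum_imp_sums)
qed

text \<open>Moving the weight from \<open>j\<close> to \<open>j + k\<close> dominates the series by
  a multiple of a tail of the given one.\<close>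

lemma summable_alpha_conv_shift:
  assumes "summable (\<lambda>k. pmf alpha k * \<bar>f k\<bar>)"
  shows "summable (\<lambda>j. alpha_conv n j * \<bar>f (j + k)\<bar>)"
proof (rule summable_comparison_test')
  show "summable (\<lambda>j. real (n + 2) * 4 ^ k * (pmf alpha (j + k) * \<bar>f (j + k)\<bar>))"
    by (intro summable_mult summable_ignore_initial_segment[OF assms])
  fix j assume "j \<ge> (0::nat)"
  have "alpha_conv n j \<le> real (n + 2) * (4 ^ k * pmf alpha (j + k))"
    by (rule order_trans[OF alpha_conv_le])
      (intro mult_left_mono pmf_alpha_le_shift, simp)
  then have "alpha_conv n j * \<bar>f (j + k)\<bar> \<le>
      real (n + 2) * (4 ^ k * pmf alpha (j + k)) * \<bar>f (j + k)\<bar>"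
    by (rule mult_right_mono) simp
  then show "norm (alpha_conv n j * \<bar>f (j + k)\<bar>) \<le>
      real (n + 2) * 4 ^ k * (pmf alpha (j + k) * \<bar>f (j + k)\<bar>)"
    using alpha_conv_nonneg[of n j] by (simp add: mult_ac)
qed

lemma summable_alpha_conv_shift':
  assumes "summable (\<lambda>k. pmf alpha k * \<bar>f k\<bar>)"
  shows "summable (\<lambda>j. alpha_conv n j * f (j + k))"
  by (rule summable_rabs_cancel)
    (use summable_alpha_conv_shift[OF assms, of n k] in \<open>simp add: abs_mult alpha_conv_nonneg\<close>)

lemma alpha_op_funpow:
  assumes "summable (\<lambda>k. pmf alpha k * \<bar>f k\<bar>)"
  shows "(alpha_op ^^ n) f k = (\<Sum>j. alpha_conv n j * f (j + k))"
proof (induction n arbitrary: k)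
  case 0
  have "(\<lambda>j. alpha_conv 0 j * f (j + k)) = (\<lambda>j. if j = 0 then f k else 0)"
    by (auto simp: alpha_conv_0)
  then show ?case using sums_single[of 0 "\<lambda>_. f k"] by (simp add: sums_iff)
next
  case (Suc n)
  have "(\<lambda>i. pmf alpha i * (\<Sum>j. alpha_conv n j * f (i + j + k))) sums
      (\<Sum>m. (\<Sum>i\<le>m. pmf alpha i * alpha_conv n (m - i)) * f (m + k))"
    by (rule sums_convolution[where g = "\<lambda>m. f (m + k)"])
      (use summable_alpha_conv_shift[OF assms, of "Suc n" k] in
        \<open>simp_all add: alpha_conv_nonneg alpha_conv_Suc\<close>)
  then show ?case
    unfolding funpow.simps comp_apply alpha_op_def[of "(alpha_op ^^ n) f"] Suc.IH
    by (simp add: sums_iff alpha_conv_Suc add_ac)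
qed

section \<open>Generating functions of the weights and escape of mass to infinity\<close>

lemma pmf_alpha_sums_1: "pmf alpha sums 1"
proof -
  have "pmf alpha = alpha_coeff"
    by (simp add: fun_eq_iff pmf_alpha alpha_coeff_def)
  then show ?thesis using alpha_coeff_sums_1 by simp
qed

text \<open>The geometric sequence \<open>x ^ k\<close> is an eigenvector of \<open>alpha_op\<close>
  with eigenvalue \<open>G\<close>; the formula is its \<open>n\<close>-th iterate read at
  0.\<close>

lemma alpha_conv_powser:
  assumes x: "0 \<le> x" "x \<le> 1" and G: "(\<lambda>j. pmf alpha j * x ^ j) sums G"
  shows "(\<lambda>j. alpha_conv n j * x ^ j) sums (G ^ n)"
proof -
  have summ: "summable (\<lambda>k. pmf alpha k * \<bar>x ^ k\<bar>)"
    using G x by (simp add: sums_iff)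
  have "(alpha_op ^^ n) (\<lambda>k. x ^ k) = (\<lambda>k. G ^ n * x ^ k)"
  proof (induction n)
    case (Suc n)
    have "(\<Sum>j. pmf alpha j * (G ^ n * x ^ (j + k))) = G ^ Suc n * x ^ k" for k
    proof -
      have "(\<lambda>j. (pmf alpha j * x ^ j) * (G ^ n * x ^ k)) sums (G * (G ^ n * x ^ k))"
        by (rule sums_mult2[OF G])
      then show ?thesis by (simp add: sums_iff power_add mult_ac)
    qed
    with Suc show ?case by (simp add: alpha_op_def fun_eq_iff)
  qed simp
  then have "G ^ n = (\<Sum>j. alpha_conv n j * x ^ j)"
    using alpha_op_funpow[OF summ, of n 0] by simp
  then show ?thesis
    using summable_alpha_conv_shift'[OF summ, of n 0] by (simp add: sums_iff)
qed

lemma alpha_conv_sums_1: "alpha_conv n sums 1"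
  using alpha_conv_powser[of 1 1 n] pmf_alpha_sums_1 by simp

lemma alpha_conv_tendsto_0: "(\<lambda>n. alpha_conv n j) \<longlonglongrightarrow> 0"
proof -
  \<comment> \<open>The value of the generating function at 1/2. Being below 1, its powers force
    every single weight to 0.\<close>
  define G :: real where "G = (1 - sqrt (1 / 2)) * 2"
  have G01: "0 \<le> G" "G < 1"
    using real_less_rsqrt[of "1/2" "1/2"] real_sqrt_le_1_iff[of "1/2"]
    by (auto simp: G_def power2_eq_square)
  have G: "(\<lambda>j. pmf alpha j * (1/2) ^ j) sums G"
    using alpha_has_sqrt_genfun unfolding has_sqrt_genfun_def
    by (auto dest!: spec[of _ "1/2"] simp: G_def)
  have le: "alpha_conv n j \<le> 2 ^ j * G ^ n" for n
  proof -
    have "alpha_conv n j * (1/2) ^ j \<le> G ^ n"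
      using alpha_conv_powser[OF _ _ G, of n] sum_le_suminf[of "\<lambda>j. alpha_conv n j * (1/2) ^ j" "{j}"]
      by (auto simp: sums_iff alpha_conv_nonneg)
    then show ?thesis by (simp add: field_simps)
  qed
  show ?thesis
  proof (rule tendsto_sandwich)
    show "\<forall>\<^sub>F n in sequentially. 0 \<le> alpha_conv n j"
      by (intro always_eventually allI alpha_conv_nonneg)
    show "\<forall>\<^sub>F n in sequentially. alpha_conv n j \<le> 2 ^ j * G ^ n"
      by (intro always_eventually allI le)
    have "(\<lambda>n. 2 ^ j * G ^ n) \<longlonglongrightarrow> 2 ^ j * 0"
      by (intro tendsto_mult tendsto_const LIMSEQ_realpow_zero G01)
    then show "(\<lambda>n. 2 ^ j * G ^ n) \<longlonglongrightarrow> 0" by simp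
  qed simp
qed

lemma alpha_op_funpow_at_top:
  assumes summ: "summable (\<lambda>k. pmf alpha k * \<bar>f k\<bar>)"
    and f: "mono f" "\<And>k. 0 \<le> f k" "filterlim f at_top sequentially"
  shows "filterlim (\<lambda>n. (alpha_op ^^ n) f k) at_top sequentially"
  unfolding filterlim_at_top
proof
  fix Z :: real
  obtain J where J: "f J \<ge> Z + 1"
    using f(3) unfolding filterlim_at_top eventually_sequentially by blast
  \<comment> \<open>Discard the mass below \<open>J\<close>; by monotonicity the remaining mass sees
    values at least \<open>f J\<close>, whatever \<open>k\<close> is.\<close>
  have ge: "f J - (\<Sum>j<J. alpha_conv n j * f J) \<le> (alpha_op ^^ n) f k" for n
    unfolding alpha_op_funpow[OF summ]
  proof (rule sums_le)
    have "(\<lambda>j. alpha_conv n j * f J - (if j \<in> {..<J} then alpha_conv n j * f J else 0)) sums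
        (1 * f J - (\<Sum>j\<in>{..<J}. alpha_conv n j * f J))"
      by (intro sums_diff sums_mult2 alpha_conv_sums_1 sums_If_finite_set) simp
    then show "(\<lambda>j. alpha_conv n j * f J - (if j \<in> {..<J} then alpha_conv n j * f J else 0)) sums
        (f J - (\<Sum>j<J. alpha_conv n j * f J))" by simp
    show "(\<lambda>j. alpha_conv n j * f (j + k)) sums (\<Sum>j. alpha_conv n j * f (j + k))"
      by (rule summable_sums[OF summable_alpha_conv_shift'[OF summ]])
    show "alpha_conv n j * f J - (if j \<in> {..<J} then alpha_conv n j * f J else 0) \<le>
        alpha_conv n j * f (j + k)" for j
      by (auto intro!: mult_left_mono mult_nonneg_nonneg monoD[OF f(1)] simp: f alpha_conv_nonneg)
  qed
  have "(\<lambda>n. f J - (\<Sum>j<J. alpha_conv n j * f J)) \<longlonglongrightarrow> f J - (\<Sum>j<J. 0 * f J)"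
    by (intro tendsto_intros alpha_conv_tendsto_0)
  then have "\<forall>\<^sub>F n in sequentially. Z < f J - (\<Sum>j<J. alpha_conv n j * f J)"
    using J by (intro order_tendstoD) auto
  then show "\<forall>\<^sub>F n in sequentially. Z \<le> (alpha_op ^^ n) f k"
    by eventually_elim (use ge in \<open>meson less_imp_le order_trans\<close>)
qed

section \<open>Norm estimates\<close>

lemma Jensen_powr_sums:
  fixes w y :: "nat \<Rightarrow> real"
  assumes p: "p \<ge> 1" and w: "\<And>j. w j \<ge> 0" "w sums 1"
    and summ: "summable (\<lambda>j. w j * \<bar>y j\<bar>)" "summable (\<lambda>j. w j * \<bar>y j\<bar> powr p)"
  shows "\<bar>\<Sum>j. w j * y j\<bar> powr p \<le> (\<Sum>j. w j * \<bar>y j\<bar> powr p)"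
proof -
  define m where "m = (\<Sum>j. w j * \<bar>y j\<bar>)"
  have m: "(\<lambda>j. w j * \<bar>y j\<bar>) sums m" unfolding m_def by (rule summable_sums[OF summ(1)])
  have "\<bar>\<Sum>j. w j * y j\<bar> \<le> m"
    using summable_rabs[of "\<lambda>j. w j * y j"] summ(1) by (simp add: m_def abs_mult w)
  then have "\<bar>\<Sum>j. w j * y j\<bar> powr p \<le> m powr p"
    using p by (intro powr_mono2) auto
  also have "m powr p \<le> (\<Sum>j. w j * \<bar>y j\<bar> powr p)"
  proof (cases "m = 0")
    case True
    then show ?thesis by (auto intro!: suminf_nonneg summ mult_nonneg_nonneg w)
  next
    case False
    have "m \<ge> 0" unfolding m_def by (auto intro!: suminf_nonneg summ mult_nonneg_nonneg w)
    with False have "m > 0" by simp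
    \<comment> \<open>the tangent line of the convex function \<open>t powr p\<close> at the mean \<open>m\<close>\<close>
    have tangent: "m powr p * (1 - p + p / m * t) \<le> t powr p" if "t \<ge> 0" for t
    proof -
      have "1 + p * (t / m - 1) \<le> (1 + (t / m - 1)) powr p"
        using \<open>m > 0\<close> that by (intro Bernoulli_powr p) auto
      also have "\<dots> = t powr p / m powr p" using \<open>m > 0\<close> that by (simp add: powr_divide)
      finally show ?thesis using \<open>m > 0\<close> by (simp add: field_simps)
    qed
    \<comment> \<open>Averaging the tangent line returns its value at the mean, as 1 - p + p =
      1.\<close>
    have "(\<lambda>j. m powr p * ((1 - p) * w j + p / m * (w j * \<bar>y j\<bar>))) sums
        (m powr p * ((1 - p) * 1 + p / m * m))"
      by (intro sums_mult sums_add w m)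
    then have "(\<lambda>j. m powr p * ((1 - p) * w j + p / m * (w j * \<bar>y j\<bar>))) sums (m powr p)"
      using \<open>m > 0\<close> by simp
    then show ?thesis
    proof (rule sums_le[rotated, OF _ summable_sums[OF summ(2)]])
      show "m powr p * ((1 - p) * w j + p / m * (w j * \<bar>y j\<bar>)) \<le> w j * \<bar>y j\<bar> powr p" for j
        using mult_left_mono[OF tangent[of "\<bar>y j\<bar>"] w(1)[of j]] by (simp add: algebra_simps)
    qed
  qed
  finally show ?thesis .
qed

text \<open>Total mass 1 embeds L_p in L_1, through t \<le> 1 + \<open>t powr p\<close> for
  nonnegative t.\<close>

lemma Lp_alpha_summable:
  assumes "p \<ge> 1" "f \<in> Lp p (measure_pmf alpha)"
  shows "summable (\<lambda>k. pmf alpha k * \<bar>f k\<bar>)"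
proof (rule summable_comparison_test')
  show "summable (\<lambda>k. pmf alpha k + pmf alpha k * \<bar>f k\<bar> powr p)"
    using assms(2) pmf_alpha_sums_1 by (intro summable_add) (auto simp: Lp_alpha_iff sums_iff)
  fix k assume "k \<ge> (0::nat)"
  have "\<bar>f k\<bar> \<le> 1 + \<bar>f k\<bar> powr p"
  proof (cases "\<bar>f k\<bar> \<le> 1")
    case False
    then have "\<bar>f k\<bar> powr 1 \<le> \<bar>f k\<bar> powr p" using assms(1) by (intro powr_mono) auto
    with False show ?thesis by simp
  qed (use powr_ge_zero[of "\<bar>f k\<bar>" p] in linarith)
  from mult_left_mono[OF this, of "pmf alpha k"]
  show "norm (pmf alpha k * \<bar>f k\<bar>) \<le> pmf alpha k + pmf alpha k * \<bar>f k\<bar> powr p"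
    by (simp add: algebra_simps)
qed

lemma alpha_op_funpow_estimate:
  assumes p: "p \<ge> 1" and f: "f \<in> Lp p (measure_pmf alpha)"
  shows alpha_op_funpow_Lp: "(alpha_op ^^ n) f \<in> Lp p (measure_pmf alpha)"
    and alpha_op_funpow_norm_le: "Lp_norm p (measure_pmf alpha) ((alpha_op ^^ n) f) \<le>
      (real n + 1) powr (1 / p) * Lp_norm p (measure_pmf alpha) f"
proof -
  define g where "g = (\<lambda>k. \<bar>f k\<bar> powr p)"
  have g: "g k \<ge> 0" for k by (simp add: g_def)
  have summ: "summable (\<lambda>k. pmf alpha k * g k)"
    using f by (simp add: Lp_alpha_iff g_def)
  then have summ': "summable (\<lambda>k. pmf alpha k * \<bar>g k\<bar>)" by (simp add: g)
  note summ1 = Lp_alpha_summable[OF assms]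
  have summ_conv: "summable (\<lambda>m. alpha_conv (Suc n) m * g m)"
    using summable_alpha_conv_shift'[OF summ', of "Suc n" 0] by simp
  \<comment> \<open>Integrating the Jensen bound against \<open>alpha\<close> adds one more
    convolution: order \<open>n\<close> becomes \<open>n + 1\<close>, whence the factor
    \<open>n + 1\<close> in the estimate.\<close>
  have conv: "(\<lambda>i. pmf alpha i * (\<Sum>j. alpha_conv n j * g (i + j))) sums
      (\<Sum>m. alpha_conv (Suc n) m * g m)"
    unfolding alpha_conv_Suc
    by (rule sums_convolution) (use summ_conv in \<open>simp_all add: alpha_conv_nonneg g alpha_conv_Suc\<close>)
  have le: "pmf alpha k * \<bar>(alpha_op ^^ n) f k\<bar> powr p \<le>
      pmf alpha k * (\<Sum>j. alpha_conv n j * g (k + j))" for k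
    unfolding alpha_op_funpow[OF summ1] g_def add.commute[of k]
    by (intro mult_left_mono Jensen_powr_sums p alpha_conv_nonneg alpha_conv_sums_1
        summable_alpha_conv_shift summ1)
      (use summable_alpha_conv_shift'[OF summ', of n k] in \<open>simp_all add: g_def\<close>)
  have S: "summable (\<lambda>k. pmf alpha k * \<bar>(alpha_op ^^ n) f k\<bar> powr p)"
    by (rule summable_comparison_test'[OF sums_summable[OF conv]]) (use le in simp)
  then show Lp: "(alpha_op ^^ n) f \<in> Lp p (measure_pmf alpha)"
    by (simp add: Lp_alpha_iff)
  have "(\<Sum>k. pmf alpha k * \<bar>(alpha_op ^^ n) f k\<bar> powr p) \<le> (\<Sum>m. alpha_conv (Suc n) m * g m)"
    using suminf_le[OF le S sums_summable[OF conv]] conv by (simp add: sums_iff)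
  also have "\<dots> \<le> (\<Sum>m. real (Suc n) * (pmf alpha m * g m))"
    using mult_right_mono[OF alpha_conv_Suc_le g]
    by (intro suminf_le summ_conv summable_mult summ) (simp add: mult.assoc)
  also have "\<dots> = (real n + 1) * (\<Sum>m. pmf alpha m * g m)"
    using suminf_mult[OF summ, of "real (Suc n)"] by simp
  finally have "(\<Sum>k. pmf alpha k * \<bar>(alpha_op ^^ n) f k\<bar> powr p) powr (1 / p) \<le>
      ((real n + 1) * (\<Sum>m. pmf alpha m * g m)) powr (1 / p)"
    using p by (intro powr_mono2) (auto intro!: suminf_nonneg S)
  also have "\<dots> = (real n + 1) powr (1 / p) * (\<Sum>m. pmf alpha m * g m) powr (1 / p)"
    by (intro powr_mult)
  finally show "Lp_norm p (measure_pmf alpha) ((alpha_op ^^ n) f) \<le>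
      (real n + 1) powr (1 / p) * Lp_norm p (measure_pmf alpha) f"
    by (simp add: Lp_norm_alpha[OF Lp] Lp_norm_alpha[OF f] g_def)
qed

section \<open>From pointwise growth to growth of norms, and operator norms\<close>

lemma Lp_norm_cmult:
  assumes "p > 0"
  shows "Lp_norm p M (\<lambda>x. c * f x) = \<bar>c\<bar> * Lp_norm p M f"
  using assms by (simp add: Lp_norm_def abs_mult powr_mult powr_powr)

lemma Lp_cmult:
  assumes "f \<in> Lp p M"
  shows "(\<lambda>x. c * f x) \<in> Lp p M"
  using assms by (auto simp: Lp_def abs_mult powr_mult)

lemma Lp_norm_nonneg: "Lp_norm p M f \<ge> 0"
  by (simp add: Lp_norm_def)

text \<open>The atom at 0, of mass 1/2, alone bounds the norm from below, so divergence at the point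
  0 passes to the norm.\<close>

lemma Lp_norm_ge_at_0:
  assumes "p > 0" "f \<in> Lp p (measure_pmf alpha)"
  shows "(1 / 2) powr (1 / p) * f 0 \<le> Lp_norm p (measure_pmf alpha) f"
proof -
  have "(1 / 2) powr (1 / p) * f 0 \<le> (1 / 2) powr (1 / p) * \<bar>f 0\<bar>"
    by (intro mult_left_mono) auto
  also have "\<dots> = (pmf alpha 0 * \<bar>f 0\<bar> powr p) powr (1 / p)"
    using assms(1) by (simp add: pmf_alpha_0 powr_mult powr_powr powr_divide)
  also have "\<dots> \<le> (\<Sum>k. pmf alpha k * \<bar>f k\<bar> powr p) powr (1 / p)"
    using assms sum_le_suminf[of "\<lambda>k. pmf alpha k * \<bar>f k\<bar> powr p" "{0}"]
    by (intro powr_mono2) (auto simp: Lp_alpha_iff)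
  finally show ?thesis by (simp add: Lp_norm_alpha[OF assms(2)])
qed

lemma alpha_op_funpow_norm_at_top:
  assumes p: "p \<ge> 1" and f: "f \<in> Lp p (measure_pmf alpha)"
    and "mono f" "\<And>k. 0 \<le> f k" "filterlim f at_top sequentially"
  shows "filterlim (\<lambda>n. Lp_norm p (measure_pmf alpha) ((alpha_op ^^ n) f)) at_top sequentially"
proof (rule filterlim_at_top_mono)
  show "filterlim (\<lambda>n. (1 / 2) powr (1 / p) * (alpha_op ^^ n) f 0) at_top sequentially"
    by (intro filterlim_tendsto_pos_mult_at_top[OF tendsto_const]
        alpha_op_funpow_at_top Lp_alpha_summable[OF p f] assms) simp
  show "\<forall>\<^sub>F n in sequentially. (1 / 2) powr (1 / p) * (alpha_op ^^ n) f 0 \<le>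
      Lp_norm p (measure_pmf alpha) ((alpha_op ^^ n) f)"
    using p by (intro always_eventually allI Lp_norm_ge_at_0 alpha_op_funpow_Lp f) auto
qed

text \<open>Boundedness of the set is recorded separately because only then does the real supremum
  in \<open>Lp_opnorm\<close> dominate its members.\<close>

lemma alpha_op_funpow_opnorm_le:
  assumes p: "p \<ge> 1"
  shows bdd_above_alpha_op_funpow: "bdd_above ((\<lambda>f. Lp_norm p (measure_pmf alpha) ((alpha_op ^^ n) f)) `
      {f \<in> Lp p (measure_pmf alpha). Lp_norm p (measure_pmf alpha) f \<le> 1})" (is "bdd_above (?N ` ?B)")
    and "Lp_opnorm p (measure_pmf alpha) (alpha_op ^^ n) \<le> (real n + 1) powr (1 / p)"
    and "0 \<le> Lp_opnorm p (measure_pmf alpha) (alpha_op ^^ n)"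
proof -
  have le: "?N f \<le> (real n + 1) powr (1 / p)" if "f \<in> ?B" for f
  proof -
    have "?N f \<le> (real n + 1) powr (1 / p) * Lp_norm p (measure_pmf alpha) f"
      using that by (intro alpha_op_funpow_norm_le p) auto
    also have "\<dots> \<le> (real n + 1) powr (1 / p) * 1"
      using that by (intro mult_left_mono) auto
    finally show ?thesis by simp
  qed
  show bdd: "bdd_above (?N ` ?B)" using le by (rule bdd_aboveI2)
  have 0: "(\<lambda>_. 0) \<in> ?B" by (simp add: Lp_def Lp_norm_def)
  show "Lp_opnorm p (measure_pmf alpha) (alpha_op ^^ n) \<le> (real n + 1) powr (1 / p)"
    unfolding Lp_opnorm_def using 0 le by (intro cSUP_least) auto
  show "0 \<le> Lp_opnorm p (measure_pmf alpha) (alpha_op ^^ n)"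
    unfolding Lp_opnorm_def by (rule cSUP_upper2[OF bdd 0 Lp_norm_nonneg])
qed

lemma Lp_norm_le_alpha_op_opnorm:
  assumes "p \<ge> 1" "f \<in> Lp p (measure_pmf alpha)" "Lp_norm p (measure_pmf alpha) f \<le> 1"
  shows "Lp_norm p (measure_pmf alpha) ((alpha_op ^^ n) f) \<le>
    Lp_opnorm p (measure_pmf alpha) (alpha_op ^^ n)"
  unfolding Lp_opnorm_def
  by (rule cSUP_upper[OF _ bdd_above_alpha_op_funpow]) (use assms in auto)

text \<open>The terms decay like k^(q p - 3/2), which is summable because q p < 1/2.\<close>

lemma powr_in_Lp_alpha:
  assumes "p > 0" "q \<ge> 0" "q * p < 1 / 2"
  shows "(\<lambda>k. real k powr q) \<in> Lp p (measure_pmf alpha)"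
  unfolding Lp_alpha_iff
proof (rule summable_comparison_test')
  have "summable (\<lambda>k. real k powr (q * p - 3/2))"
    using assms by (subst summable_real_powr_iff) auto
  then show "summable (\<lambda>k. real (Suc k) powr (q * p - 3/2))"
    by (subst summable_Suc_iff)
  fix k assume "k \<ge> (0::nat)"
  have "pmf alpha k * real k powr (q * p) \<le> (real k + 1) powr (-3/2) * (real k + 1) powr (q * p)"
    using assms by (intro mult_mono pmf_alpha_le powr_mono2) auto
  also have "\<dots> = real (Suc k) powr (q * p - 3/2)"
    by (simp add: powr_add[symmetric] add.commute)
  finally show "norm (pmf alpha k * \<bar>real k powr q\<bar> powr p) \<le> real (Suc k) powr (q * p - 3/2)"
    by (simp add: powr_powr)
qed

lemma alpha_op_bounded_linear:
  assumes p: "p \<ge> 1"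
  shows "Lp_bounded_linear p (measure_pmf alpha) alpha_op"
  unfolding Lp_bounded_linear_def AE_alpha_iff
\<comment> \<open>Every point has positive mass, so almost everywhere has become everywhere.\<close>
proof (intro conjI ballI allI impI)
  fix f g assume f: "f \<in> Lp p (measure_pmf alpha)"
  note summ = Lp_alpha_summable[OF p, THEN summable_alpha_conv_shift'[where n = "Suc 0"],
      unfolded alpha_conv_1]
  show "alpha_op f \<in> Lp p (measure_pmf alpha)"
    using alpha_op_funpow_Lp[OF p f, of 1] by simp
  show "alpha_op (\<lambda>y. c * f y) k = c * alpha_op f k" for c k
    using suminf_mult[OF summ[OF f, of k], of c] by (simp add: alpha_op_def mult_ac)
  assume g: "g \<in> Lp p (measure_pmf alpha)"
  show "alpha_op (\<lambda>y. f y + g y) k = alpha_op f k + alpha_op g k" for k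
    using suminf_add[OF summ[OF f, of k] summ[OF g, of k]] by (simp add: alpha_op_def algebra_simps)
  assume "\<forall>k. f k = g k"
  then have "f = g" by auto
  then show "alpha_op f k = alpha_op g k" for k by simp
next
  show "\<exists>C. \<forall>f\<in>Lp p (measure_pmf alpha).
      Lp_norm p (measure_pmf alpha) (alpha_op f) \<le> C * Lp_norm p (measure_pmf alpha) f"
    using alpha_op_funpow_norm_le[OF p, of _ 1] by auto
qed

lemma alpha_op_subadditive_powers:
  assumes p: "p \<ge> 1"
  shows "Lp_subadditive_powers p (measure_pmf alpha) alpha_op"
  unfolding Lp_subadditive_powers_def Lp_op_le_def AE_alpha_iff
proof (intro allI ballI impI)
  fix n m f k assume f: "f \<in> Lp p (measure_pmf alpha)" and nonneg: "\<forall>k. 0 \<le> f k"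
  note summ = Lp_alpha_summable[OF p f]
  note s = summable_alpha_conv_shift'[OF summ, of _ k]
  have "(\<Sum>j. alpha_conv (n + m) j * f (j + k)) \<le>
      (\<Sum>j. alpha_conv n j * f (j + k) + alpha_conv m j * f (j + k))"
    using mult_right_mono[OF alpha_conv_subadditive] nonneg
    by (intro suminf_le s summable_add) (simp add: distrib_right[symmetric])
  then show "(alpha_op ^^ (n + m)) f k \<le> (alpha_op ^^ n) f k + (alpha_op ^^ m) f k"
    by (simp add: alpha_op_funpow[OF summ] suminf_add[OF s s])
qed

text \<open>The bound \<open>(n + 1) powr (1 / p)\<close> is o(n) because
  \<open>p > 1\<close>.\<close>

lemma alpha_op_opnorm_div_tendsto_0:
  assumes p: "p > 1"
  shows "(\<lambda>n. Lp_opnorm p (measure_pmf alpha) (alpha_op ^^ n) / real n) \<longlonglongrightarrow> 0"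
proof (rule tendsto_sandwich[OF _ _ tendsto_const])
  show "(\<lambda>n. (real n + 1) powr (1 / p) / real n) \<longlonglongrightarrow> 0"
  proof -
    define q where "q = 1 / p"
    have "q < 1" using p by (simp add: q_def)
    then show ?thesis unfolding q_def[symmetric] by real_asymp
  qed
qed (use alpha_op_funpow_opnorm_le[of p] p in \<open>auto intro!: always_eventually divide_right_mono\<close>)

section \<open>The growing function and the two counterexamples\<close>

theorem mainTheorem1:
  fixes p :: real
  assumes "1 < p"
  shows
    "(\<forall>f\<in>Lp p (measure_pmf alpha). \<forall>k. summable (\<lambda>j. \<bar>pmf alpha j * f (j + k)\<bar>)) \<and>
     Lp_bounded_linear p (measure_pmf alpha) alpha_op \<and>
     Lp_positive p (measure_pmf alpha) alpha_op \<and>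
     Lp_subadditive_powers p (measure_pmf alpha) alpha_op \<and>
     (\<lambda>n. Lp_opnorm p (measure_pmf alpha) (alpha_op ^^ n) / real n) \<longlonglongrightarrow> 0 \<and>
     (SUP n. ereal (Lp_opnorm p (measure_pmf alpha) (alpha_op ^^ n))) = \<infinity> \<and>
     (\<exists>f\<in>Lp p (measure_pmf alpha). \<forall>k. \<not> convergent (\<lambda>n. (alpha_op ^^ n) f k)) \<and>
     (let f = (\<lambda>k. real k powr (2 / (5 * p))) in
        f \<in> Lp p (measure_pmf alpha) \<and>
        (\<forall>k. filterlim (\<lambda>n. (alpha_op ^^ n) f k) at_top sequentially) \<and>
        filterlim (\<lambda>n. Lp_norm p (measure_pmf alpha) ((alpha_op ^^ n) f)) at_top sequentially) \<and>
     \<not> (\<forall>(M :: nat measure) T.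
          Lp_bounded_linear p M T \<and> Lp_positive p M T \<and> Lp_subadditive_powers p M T \<and>
          (\<lambda>n. Lp_opnorm p M (T ^^ n) / real n) \<longlonglongrightarrow> 0 \<longrightarrow>
          bdd_above (range (\<lambda>n. Lp_opnorm p M (T ^^ n)))) \<and>
     \<not> (\<forall>(M :: nat measure) T.
          Lp_bounded_linear p M T \<and> Lp_positive p M T \<and> Lp_subadditive_powers p M T \<and>
          (\<lambda>n. Lp_opnorm p M (T ^^ n) / real n) \<longlonglongrightarrow> 0 \<longrightarrow>
          (\<forall>f\<in>Lp p M. AE x in M. convergent (\<lambda>n. (T ^^ n) f x)))"
proof -
  let ?M = "measure_pmf alpha"
  have p: "p \<ge> 1" "p > 0" using assms by simp_all
  define f where "f = (\<lambda>k. real k powr (2 / (5 * p)))"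
  \<comment> \<open>The exponent times \<open>p\<close> is 2/5, just below the threshold
    1/2.\<close>
  have f: "f \<in> Lp p ?M"
    unfolding f_def by (rule powr_in_Lp_alpha) (use p in auto)
  have f': "mono f" "\<And>k. 0 \<le> f k" "filterlim f at_top sequentially"
  proof -
    show "mono f" using p by (auto simp: f_def mono_def intro!: powr_mono2)
    define q where "q = 2 / (5 * p)"
    have "q > 0" using p by (simp add: q_def)
    then show "filterlim f at_top sequentially" unfolding f_def q_def[symmetric] by real_asymp
  qed (simp add: f_def)
  have f_op: "filterlim (\<lambda>n. (alpha_op ^^ n) f k) at_top sequentially" for k
    by (intro alpha_op_funpow_at_top Lp_alpha_summable[OF p(1) f] f')
  then have f_div: "\<not> convergent (\<lambda>n. (alpha_op ^^ n) f k)" for k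
    using not_tendsto_and_filterlim_at_infinity[OF sequentially_bot]
    by (auto simp: convergent_def dest: filterlim_at_top_imp_at_infinity)
  have unbounded: "\<exists>n. B \<le> Lp_opnorm p ?M (alpha_op ^^ n)" for B
  proof -
    \<comment> \<open>Scaling \<open>f\<close> into the unit ball turns its growing norms into lower
      bounds for the operator norms; the added 1 keeps the denominator positive.\<close>
    define c where "c = 1 / (Lp_norm p ?M f + 1)"
    define g where "g = (\<lambda>k. c * f k)"
    have c: "c > 0" using Lp_norm_nonneg[of p ?M f] by (simp add: c_def)
    have g: "g \<in> Lp p ?M" unfolding g_def by (rule Lp_cmult[OF f])
    have g1: "Lp_norm p ?M g \<le> 1"
      using c Lp_norm_nonneg[of p ?M f] unfolding g_def Lp_norm_cmult[OF p(2)]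
      by (simp add: c_def divide_simps)
    have "filterlim (\<lambda>n. Lp_norm p ?M ((alpha_op ^^ n) g)) at_top sequentially"
    proof (rule alpha_op_funpow_norm_at_top[OF p(1) g])
      show "mono g" using c f'(1) by (simp add: g_def mono_def)
      show "0 \<le> g k" for k using c f'(2) by (simp add: g_def)
      show "filterlim g at_top sequentially"
        unfolding g_def using c by (intro filterlim_tendsto_pos_mult_at_top[OF tendsto_const] f')
    qed
    then obtain n where "B \<le> Lp_norm p ?M ((alpha_op ^^ n) g)"
      unfolding filterlim_at_top eventually_sequentially by blast
    with Lp_norm_le_alpha_op_opnorm[OF p(1) g g1] show ?thesis by (meson order_trans)
  qed
  have abs_summ: "summable (\<lambda>j. \<bar>pmf alpha j * h (j + k)\<bar>)" if "h \<in> Lp p ?M" for h k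
    using summable_alpha_conv_shift[OF Lp_alpha_summable[OF p(1) that], of "Suc 0" k]
    by (simp add: alpha_conv_1 abs_mult)
  have positive: "Lp_positive p ?M alpha_op"
    unfolding Lp_positive_def AE_alpha_iff
    by (auto simp: alpha_op_def intro!: suminf_nonneg summable_rabs_cancel[OF abs_summ])
  note operator = alpha_op_bounded_linear[OF p(1)] positive alpha_op_subadditive_powers[OF p(1)]
    alpha_op_opnorm_div_tendsto_0[OF assms]
  have sup: "(SUP n. ereal (Lp_opnorm p ?M (alpha_op ^^ n))) = \<infinity>"
    by (rule SUP_PInfty) (use unbounded in auto)
  have not_bdd: "\<not> bdd_above (range (\<lambda>n. Lp_opnorm p ?M (alpha_op ^^ n)))"
  proof
    assume "bdd_above (range (\<lambda>n. Lp_opnorm p ?M (alpha_op ^^ n)))"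
    then obtain B where "Lp_opnorm p ?M (alpha_op ^^ n) \<le> B" for n
      unfolding bdd_above_def by auto
    moreover obtain n where "B + 1 \<le> Lp_opnorm p ?M (alpha_op ^^ n)" using unbounded by blast
    ultimately show False by (meson less_add_one linorder_not_less order_trans)
  qed
  have not_conv: "\<not> (\<forall>h\<in>Lp p ?M. AE x in ?M. convergent (\<lambda>n. (alpha_op ^^ n) h x))"
    using f f_div by (auto simp: AE_alpha_iff)
  show ?thesis
    unfolding f_def[symmetric] Let_def
  proof (intro conjI operator sup f allI ballI abs_summ f_op
      alpha_op_funpow_norm_at_top[OF p(1) f f'] bexI[OF _ f] f_div notI)
    \<comment> \<open>Both universal claims are refuted by the measure \<open>alpha\<close> and the
      operator \<open>alpha_op\<close>.\<close>
    assume "\<forall>(M :: nat measure) T.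
        Lp_bounded_linear p M T \<and> Lp_positive p M T \<and> Lp_subadditive_powers p M T \<and>
        (\<lambda>n. Lp_opnorm p M (T ^^ n) / real n) \<longlonglongrightarrow> 0 \<longrightarrow>
        bdd_above (range (\<lambda>n. Lp_opnorm p M (T ^^ n)))"
    from this[THEN spec, THEN spec, THEN mp, of ?M alpha_op] show False
      using operator not_bdd by simp
  next
    assume "\<forall>(M :: nat measure) T.
        Lp_bounded_linear p M T \<and> Lp_positive p M T \<and> Lp_subadditive_powers p M T \<and>
        (\<lambda>n. Lp_opnorm p M (T ^^ n) / real n) \<longlonglongrightarrow> 0 \<longrightarrow>
        (\<forall>f\<in>Lp p M. AE x in M. convergent (\<lambda>n. (T ^^ n) f x))"
    from this[THEN spec, THEN spec, THEN mp, of ?M alpha_op] show False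
      using operator not_conv by simp
  qed
qed

end
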